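(* Let $n$ be a positive integer, $m$ a non-negative integer and $p$ an integer. In each identity below either all upper signs or all lower signs are taken. (i) If $p$, $m$ and $n$ are all odd, then $$\sum_{k=0}^n(-1)^{n-k}\frac{n}{n+k}\binom{n+k}{n-k}\bigl(2\pm\sqrt5\,F_{pm}\bigr)^k=\pm\frac{\sqrt5}{2}F_{pmn}.$$ (ii) If $p$ is odd and $m$ is even, then $$\sum_{k=0}^n(-1)^{n-k}\frac{n}{n+k}\binom{n+k}{n-k}\bigl(2\pm L_{pm}\bigr)^k=\frac{(\pm1)^n}{2}L_{pmn}.$$ (iii) If $p$ is even, then $$\sum_{k=0}^n(-1)^{n-k}\frac{n}{n+k}\binom{n+k}{n-k}\bigl(2\pm L_{pm}\bigr)^k=\frac{(\pm1)^n}{2}L_{pmn}.$$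
   Context: $F_n$ and $L_n$ ($n\in\mathbb{Z}$) are the Fibonacci and Lucas numbers: $F_0=0$, $F_1=1$, $F_n=F_{n-1}+F_{n-2}$; $L_0=2$, $L_1=1$, $L_n=L_{n-1}+L_{n-2}$, extended to negative indices by $F_{-n}=(-1)^{n-1}F_n$, $L_{-n}=(-1)^nL_n$. The convention $0^0=1$ is used. *)

theory Defs
  imports "HOL-Number_Theory.Fib"
begin

fun lucas :: "nat \<Rightarrow> nat" where
  "lucas 0 = 2"
| "lucas (Suc 0) = 1"
| "lucas (Suc (Suc n)) = lucas (Suc n) + lucas n"

text \<open>
  Extension to negative indices by $F_{-n} = (-1)^{n-1} F_n$ and $L_{-n} = (-1)^n L_n$.
\<close>

definition fib_int :: "int \<Rightarrow> int" where
  "fib_int k = (if k \<ge> 0 then int (fib (nat k))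
                else (-1) ^ (nat (- k) - 1) * int (fib (nat (- k))))"

definition lucas_int :: "int \<Rightarrow> int" where
  "lucas_int k = (if k \<ge> 0 then int (lucas (nat k))
                  else (-1) ^ nat (- k) * int (lucas (nat (- k))))"

end

theory Submission
  imports Defs Complex_Main
begin

text \<open>
  For $x = 2 + z + z^{-1}$ the sum is $(z^n + z^{-n})/2$. Indeed
  $\frac{2n}{n+k}\binom{n+k}{n-k} = \binom{n+k}{2k} + \binom{n-1+k}{2k}$, so twice the sum is
  $B_n - B_{n-1}$ with $B_n = \sum_k (-1)^{n+k}\binom{n+k}{2k}x^k$, and Pascal's rule gives
  $B_{n+2} = (x-2)B_{n+1} - B_n$, the recurrence satisfied by the powers of $z$ and $z^{-1}$.
  By Binet's formulas, $z = \pm\varphi^{pm}$ ($\varphi$ the golden ratio) yields all three identities.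
\<close>

text \<open>This is \<open>B_n\<close> of the overview: up to sign, a Morgan-Voyce polynomial
  evaluated at \<open>-x\<close>. The exponent \<open>n + k\<close> has the parity of
  \<open>n - k\<close> and avoids truncated subtraction.\<close>

definition even_binom_sum :: "'a::comm_ring_1 \<Rightarrow> nat \<Rightarrow> 'a" where
  "even_binom_sum x n = (\<Sum>k\<le>n. (-1) ^ (n + k) * of_nat ((n + k) choose (2 * k)) * x ^ k)"

text \<open>The companion that Pascal's rule produces from \<open>even_binom_sum\<close>; it splits
  the second-order recurrence into two first-order ones.\<close>

definition odd_binom_sum :: "'a::comm_ring_1 \<Rightarrow> nat \<Rightarrow> 'a" where
  "odd_binom_sum x n = (\<Sum>k\<le>n. (-1) ^ (n + k) * of_nat (Suc (n + k) choose Suc (2 * k)) * x ^ k)"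

text \<open>Pascal's rule for (n+k+2 choose 2k+2): the part with lower index 2k+1 gives
  \<open>x\<close> times the odd sum, the part with 2k+2 gives the even sum for \<open>n\<close>
  with the sign reversed.\<close>

lemma even_binom_sum_Suc:
  "even_binom_sum x (Suc n) = x * odd_binom_sum x n - even_binom_sum x n"
proof -
  let ?f = "\<lambda>k. (-1) ^ (n + k) * of_nat ((n + k) choose (2 * k)) * x ^ k"
  let ?g = "\<lambda>k. (-1) ^ (n + k) * of_nat (Suc (n + k) choose Suc (2 * k)) * x ^ k"
  \<comment> \<open>The added term contains (2n+1 choose 2n+2) = 0; after splitting off
    \<open>k = 0\<close>, both even sums run over \<open>k \<le> n\<close>.\<close>
  have "even_binom_sum x n = sum ?f {..Suc n}"
    unfolding even_binom_sum_def by (simp add: binomial_eq_0)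
  also have "\<dots> = ?f 0 + (\<Sum>k\<le>n. ?f (Suc k))"
    by (rule sum.atMost_Suc_shift)
  finally have B: "even_binom_sum x n = ?f 0 + (\<Sum>k\<le>n. ?f (Suc k))" .
  have "even_binom_sum x (Suc n) = - ?f 0 +
      (\<Sum>k\<le>n. (-1) ^ (Suc n + Suc k) * of_nat ((Suc n + Suc k) choose (2 * Suc k)) * x ^ Suc k)"
    unfolding even_binom_sum_def sum.atMost_Suc_shift by simp
  also have "\<dots> = - ?f 0 + (\<Sum>k\<le>n. x * ?g k - ?f (Suc k))"
    by (simp add: algebra_simps)
  also have "\<dots> = x * odd_binom_sum x n - even_binom_sum x n"
    unfolding B odd_binom_sum_def by (simp only: sum_subtractf sum_distrib_left) simp
  finally show ?thesis .
qed

text \<open>Pascal's rule for (n+k+2 choose 2k+1), termwise, once the odd sum for \<open>n\<close>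
  is padded with a zero term.\<close>

lemma odd_binom_sum_Suc:
  "odd_binom_sum x (Suc n) = even_binom_sum x (Suc n) - odd_binom_sum x n"
proof -
  have "odd_binom_sum x n =
      (\<Sum>k\<le>Suc n. (-1) ^ (n + k) * of_nat (Suc (n + k) choose Suc (2 * k)) * x ^ k)"
    unfolding odd_binom_sum_def by (simp add: binomial_eq_0)
  then show ?thesis
    unfolding odd_binom_sum_def [of x "Suc n"] even_binom_sum_def
    by (simp only: sum_subtractf [symmetric]) (rule sum.cong; simp add: algebra_simps)
qed

lemma even_binom_sum_Suc_Suc:
  "even_binom_sum x (Suc (Suc n)) = (x - 2) * even_binom_sum x (Suc n) - even_binom_sum x n"
proof -
  have "even_binom_sum x (Suc (Suc n)) =
      x * (even_binom_sum x (Suc n) - odd_binom_sum x n) - even_binom_sum x (Suc n)"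
    by (simp only: even_binom_sum_Suc [of x "Suc n"] odd_binom_sum_Suc)
  also have "x * odd_binom_sum x n = even_binom_sum x (Suc n) + even_binom_sum x n"
    by (simp add: even_binom_sum_Suc)
  ultimately show ?thesis
    by (simp add: algebra_simps)
qed

text \<open>With \<open>x - 2 = z + inverse z\<close>, both sides satisfy the same second-order
  linear recurrence, so two initial values suffice.\<close>

lemma even_binom_sum_diff_eq:
  fixes z :: "'a::field"
  assumes "z \<noteq> 0"
  shows "even_binom_sum (2 + z + inverse z) (Suc n) - even_binom_sum (2 + z + inverse z) n
    = z ^ Suc n + inverse z ^ Suc n"
proof (induction n rule: induct_nat_012)
  case 0
  show ?case by (simp add: even_binom_sum_def numeral_2_eq_2)
next
  case 1
  show ?case using assms
    by (simp add: even_binom_sum_Suc_Suc) (simp add: even_binom_sum_def numeral_2_eq_2 field_simps)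
next
  case (ge2 n)
  let ?B = "even_binom_sum (2 + z + inverse z)"
  have "?B (Suc (Suc (Suc n))) - ?B (Suc (Suc n)) =
      (z + inverse z) * (?B (Suc (Suc n)) - ?B (Suc n)) - (?B (Suc n) - ?B n)"
    by (simp add: even_binom_sum_Suc_Suc [of _ "Suc n"] even_binom_sum_Suc_Suc [of _ n] algebra_simps)
  also have "\<dots> = z ^ Suc (Suc (Suc n)) + inverse z ^ Suc (Suc (Suc n))"
    unfolding ge2 using assms by (simp add: field_simps)
  finally show ?case .
qed

text \<open>With N = n + 1, absorption gives (N-k) (N+k choose 2k) = (N+k) (N-1+k choose 2k), and 1
  + (N-k)/(N+k) = 2N/(N+k).\<close>

lemma binomial_weighted_eq:
  assumes "k \<le> Suc n"
  shows "real (Suc n) / real (Suc n + k) * real ((Suc n + k) choose (Suc n - k))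
    = (real ((Suc n + k) choose (2 * k)) + real ((n + k) choose (2 * k))) / 2"
proof -
  have "(Suc n + k) choose (Suc n - k) = (Suc n + k) choose (2 * k)"
    using assms by (subst binomial_symmetric) (auto intro!: arg_cong2 [where f = binomial])
  moreover have "(Suc n - k) * (Suc (n + k) choose (2 * k)) = Suc (n + k) * ((n + k) choose (2 * k))"
    using assms binomial_absorb_comp [of "Suc (n + k)" "2 * k"] by simp
  then have "(real (Suc n) - real k) * real (Suc (n + k) choose (2 * k))
      = real (Suc (n + k)) * real ((n + k) choose (2 * k))"
    using assms by (metis of_nat_diff of_nat_mult)
  ultimately show ?thesis
    by (simp add: field_simps)
qed

lemma binomial_weighted_sum_eq:
  fixes z :: real
  assumes "n > 0" "z \<noteq> 0"
  shows "(\<Sum>k=0..n. (-1) ^ (n - k) * (real n / real (n + k)) * real ((n + k) choose (n - k))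
    * (2 + z + inverse z) ^ k) = (z ^ n + inverse z ^ n) / 2"
proof -
  obtain j where n: "n = Suc j"
    using assms(1) gr0_implies_Suc by blast
  let ?x = "2 + z + inverse z"
  let ?c = "\<lambda>n k. (-1) ^ (n + k) * real ((n + k) choose (2 * k)) * ?x ^ k"
  have "(\<Sum>k=0..n. (-1) ^ (n - k) * (real n / real (n + k)) * real ((n + k) choose (n - k)) * ?x ^ k)
      = (\<Sum>k\<le>Suc j. (?c (Suc j) k - ?c j k) / 2)"
    unfolding atLeast0AtMost n
  proof (rule sum.cong)
    fix k assume "k \<in> {..Suc j}"
    then have k: "k \<le> Suc j" by simp
    then obtain d where "Suc j = k + d"
      using le_Suc_ex by blast
    then have sgn: "(-1::real) ^ (Suc j - k) = (-1) ^ (Suc j + k)"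
      by (simp add: minus_one_power_iff)
    \<comment> \<open>Lowering \<open>Suc j\<close> to \<open>j\<close> flips the sign inside
      \<open>?c\<close>, so the sum of the two binomials becomes a difference.\<close>
    show "(-1) ^ (Suc j - k) * (real (Suc j) / real (Suc j + k))
        * real ((Suc j + k) choose (Suc j - k)) * ?x ^ k = (?c (Suc j) k - ?c j k) / 2"
      unfolding sgn mult.assoc [of _ "real (Suc j) / real (Suc j + k)"] binomial_weighted_eq [OF k]
      by (simp add: algebra_simps add_divide_distrib)
  qed simp
  also have "\<dots> = (sum (?c (Suc j)) {..Suc j} - sum (?c j) {..Suc j}) / 2"
    by (simp only: sum_subtractf sum_divide_distrib [symmetric])
  \<comment> \<open>The top term contains (2j+1 choose 2j+2) = 0.\<close>
  also have "sum (?c j) {..Suc j} = sum (?c j) {..j}"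
    by (simp add: binomial_eq_0)
  finally show ?thesis
    using even_binom_sum_diff_eq [OF assms(2), of j] by (simp add: even_binom_sum_def n)
qed

definition golden :: real where
  "golden = (1 + sqrt 5) / 2"

lemma golden_pos: "golden > 0"
  by (simp add: golden_def add_pos_pos)

lemma golden_square: "golden * golden = golden + 1"
  by (simp add: golden_def field_simps)

lemma inverse_golden: "inverse golden = golden - 1"
  using golden_square golden_pos by (simp add: field_simps)

lemma golden_power_Suc_Suc: "golden ^ Suc (Suc k) = golden ^ Suc k + golden ^ k"
proof -
  have "golden ^ Suc (Suc k) = golden * golden * golden ^ k"
    by simp
  then show ?thesis
    by (simp only: golden_square) (simp add: algebra_simps)
qed

text \<open>\<open>- inverse golden\<close> is the other root of t^2 = t + 1. Written this way, its
  powers are those of \<open>inverse golden\<close> up to a sign given by the parity of the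
  exponent.\<close>

lemma golden_conj_power_Suc_Suc:
  "(- inverse golden) ^ Suc (Suc k) = (- inverse golden) ^ Suc k + (- inverse golden) ^ k"
proof -
  have "inverse golden * inverse golden = 1 - inverse golden"
    unfolding inverse_golden using golden_square by (simp add: algebra_simps)
  moreover have "(- inverse golden) ^ Suc (Suc k) = inverse golden * inverse golden * (- inverse golden) ^ k"
    by simp
  ultimately show ?thesis
    by (simp only:) (simp add: algebra_simps)
qed

lemma fib_binet: "sqrt 5 * real (fib k) = golden ^ k - (- inverse golden) ^ k"
proof (induction k rule: fib.induct)
  case 2
  show ?case unfolding inverse_golden by (simp add: golden_def field_simps)
next
  case (3 k)
  then show ?case
    unfolding golden_power_Suc_Suc golden_conj_power_Suc_Suc by (simp add: algebra_simps)
qed simp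

lemma lucas_binet: "real (lucas k) = golden ^ k + (- inverse golden) ^ k"
proof (induction k rule: lucas.induct)
  case 2
  show ?case unfolding inverse_golden by (simp add: golden_def field_simps)
next
  case (3 k)
  then show ?case
    unfolding golden_power_Suc_Suc golden_conj_power_Suc_Suc by (simp add: algebra_simps)
qed simp

text \<open>An odd power of \<open>- inverse golden\<close> is negative, which turns the difference
  in Binet's formula into a sum.\<close>

lemma fib_int_odd:
  assumes "odd k"
  shows "sqrt 5 * real_of_int (fib_int k) = golden powi k + inverse (golden powi k)"
proof (cases "k \<ge> 0")
  case True
  then have "odd (nat k)" using assms by (simp add: even_nat_iff)
  then show ?thesis using True
    by (simp add: fib_int_def fib_binet power_int_def power_inverse)
next
  \<comment> \<open>Here the sign \<open>(-1) ^ (nat (- k) - 1)\<close> is 1, and the right-hand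
    side is unchanged under \<open>k \<mapsto> -k\<close>.\<close>
  case False
  then have "odd (nat (- k))" using assms by (simp add: even_nat_iff)
  then show ?thesis using False
    by (simp add: fib_int_def fib_binet power_int_def power_inverse)
qed

lemma lucas_int_even:
  assumes "even k"
  shows "real_of_int (lucas_int k) = golden powi k + inverse (golden powi k)"
proof (cases "k \<ge> 0")
  case True
  then have "even (nat k)" using assms by (simp add: even_nat_iff)
  then show ?thesis using True
    by (simp add: lucas_int_def lucas_binet power_int_def power_inverse)
next
  case False
  then have "even (nat (- k))" using assms by (simp add: even_nat_iff)
  then show ?thesis using False
    by (simp add: lucas_int_def lucas_binet power_int_def power_inverse)
qed

text \<open>The closed form at \<open>z = s * golden powi q\<close>: since
  \<open>inverse s = s\<close>, the sign factors out of \<open>z + inverse z\<close>, and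
  \<open>s ^ n\<close> out of the n-th powers.\<close>

lemma binomial_weighted_sum_golden:
  fixes s :: real
  assumes "n > 0" and s: "s = 1 \<or> s = -1"
  shows "(\<Sum>k=0..n. (-1) ^ (n - k) * (real n / real (n + k)) * real ((n + k) choose (n - k))
      * (2 + s * (golden powi q + inverse (golden powi q))) ^ k)
    = s ^ n / 2 * (golden powi (q * int n) + inverse (golden powi (q * int n)))"
proof -
  have z: "s * golden powi q \<noteq> 0"
    using s golden_pos by auto
  have inv: "inverse s = s"
    using s by auto
  have "2 + s * (golden powi q + inverse (golden powi q))
      = 2 + s * golden powi q + inverse (s * golden powi q)"
    by (simp add: inv algebra_simps)
  then show ?thesis
    using binomial_weighted_sum_eq [OF assms(1) z]
    by (simp add: inv power_mult_distrib power_int_mult power_inverse algebra_simps add_divide_distrib)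
qed

theorem theorem4:
  fixes n m :: nat and p :: int and s :: real
  assumes "n > 0" and "s = 1 \<or> s = -1"
  shows "(odd p \<and> odd m \<and> odd n \<longrightarrow>
       (\<Sum>k=0..n. (-1) ^ (n - k) * (real n / real (n + k)) * real ((n + k) choose (n - k))
                    * (2 + s * (sqrt 5 * real_of_int (fib_int (p * int m)))) ^ k)
       = s * (sqrt 5 / 2 * real_of_int (fib_int (p * int m * int n)))) \<and>
   (odd p \<and> even m \<longrightarrow>
       (\<Sum>k=0..n. (-1) ^ (n - k) * (real n / real (n + k)) * real ((n + k) choose (n - k))
                    * (2 + s * real_of_int (lucas_int (p * int m))) ^ k)
       = s ^ n / 2 * real_of_int (lucas_int (p * int m * int n))) \<and>
   (even p \<longrightarrow>
       (\<Sum>k=0..n. (-1) ^ (n - k) * (real n / real (n + k)) * real ((n + k) choose (n - k))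
                    * (2 + s * real_of_int (lucas_int (p * int m))) ^ k)
       = s ^ n / 2 * real_of_int (lucas_int (p * int m * int n)))"
proof (intro conjI impI)
  assume odd: "odd p \<and> odd m \<and> odd n"
  then have "odd (p * int m)" "odd (p * int m * int n)"
    by simp_all
  \<comment> \<open>Oddness of \<open>n\<close> reduces the factor \<open>s ^ n\<close> of the
    general formula to the sign \<open>s\<close> required here.\<close>
  moreover have "s ^ n = s"
    using assms(2) odd by auto
  ultimately show "(\<Sum>k=0..n. (-1) ^ (n - k) * (real n / real (n + k)) * real ((n + k) choose (n - k))
      * (2 + s * (sqrt 5 * real_of_int (fib_int (p * int m)))) ^ k)
    = s * (sqrt 5 / 2 * real_of_int (fib_int (p * int m * int n)))"
    using binomial_weighted_sum_golden [OF assms, of "p * int m"]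
    by (simp flip: fib_int_odd)
next
  assume "odd p \<and> even m"
  then have "even (p * int m)" "even (p * int m * int n)"
    by simp_all
  then show "(\<Sum>k=0..n. (-1) ^ (n - k) * (real n / real (n + k)) * real ((n + k) choose (n - k))
      * (2 + s * real_of_int (lucas_int (p * int m))) ^ k)
    = s ^ n / 2 * real_of_int (lucas_int (p * int m * int n))"
    using binomial_weighted_sum_golden [OF assms, of "p * int m"]
    by (simp only: lucas_int_even)
next
  assume "even p"
  then have "even (p * int m)" "even (p * int m * int n)"
    by simp_all
  then show "(\<Sum>k=0..n. (-1) ^ (n - k) * (real n / real (n + k)) * real ((n + k) choose (n - k))
      * (2 + s * real_of_int (lucas_int (p * int m))) ^ k)
    = s ^ n / 2 * real_of_int (lucas_int (p * int m * int n))"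
    using binomial_weighted_sum_golden [OF assms, of "p * int m"]
    by (simp only: lucas_int_even)
qed

end
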